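(* The $2$-bridge knot $8_9$ and the $3$-bridge knot $4_1\#4_1$ (the connected sum of two copies of the figure-eight knot $4_1$) have the same Jones polynomial but different HOMFLY polynomials: $P(8_9)\neq P(4_1\#4_1)$.
   Context: The knots are named as in the standard (Rolfsen) knot table. The HOMFLY polynomial $P(L)=P_L(a,m)\in\mathbb{Z}[a^{\pm1},m^{\pm1}]$ is the isotopy invariant of oriented links in $S^3$ with $P(\text{unknot})=1$ and $a\,P(L_+)+a^{-1}P(L_-)+m\,P(L_0)=0$, where $L_+,L_-,L_0$ are diagrams identical except near one crossing, which is respectively a positive crossing, a negative crossing, and the orientation-respecting smoothing. The Jones polynomial is the usual one, obtained from the writhe-normalized Kauffman bracket. Plat description of the knots: consider $4$-string braids with positions $0,1,2,3$ from left to right, the string in position $0$ being straight, with $\sigma_1$ a crossing of positions $1,2$ and $\sigma_2$ a crossing of positions $2,3$ (words read from top to bottom). The plat $p_4(w)$ is obtained from the braid $w$ by joining positions $0,1$ and positions $2,3$ by crossingless unlinked arcs both at the top and at the bottom. Then $8_9=p_4(\sigma_1^{-3}\sigma_2\sigma_1^{-1}\sigma_2^{2}\sigma_1^{-1})$ and $4_1=p_4(\sigma_1^{-1}\sigma_2\sigma_1^{-2})$. The bridge number of a knot $K$ is the smallest $n$ such that $K$ has a plat presentation on $2n$ strings; an $n$-bridge knot is a knot of bridge number $n$. *)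

theory Defs
  imports Complex_Main "HOL-Library.Poly_Mapping" "HOL-Library.Product_Plus"
begin

text \<open>
  Link diagrams are sliced by horizontal lines, so that each slice contains exactly one cap (local
  maximum), cup (local minimum) or crossing besides vertical strands.  A diagram is the list of its
  slices from top to bottom; a slice \<open>(i, p)\<close> has \<open>i\<close> vertical strands to the left of the
  piece \<open>p\<close>, positions being counted from 0.

  Reading downwards, \<open>Cap\<close> creates two strands at positions \<open>i\<close> and \<open>i + 1\<close>, and \<open>Cup\<close> joins and
  ends them.  In \<open>Cross True\<close> the strand from top right
  to bottom left passes over, in \<open>Cross False\<close> the strand from top left to bottom right.

  The label of a cap carries the orientation.  In a \<open>bool diagram\<close> (an oriented diagram) it is the
  direction of the left strand of the cap, \<open>True\<close> meaning downwards; this determines the direction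
  of every strand.  A \<open>unit diagram\<close> is an unoriented diagram.
\<close>

datatype 'd piece = Cap 'd | Cup | Cross bool

type_synonym 'd diagram = "(nat \<times> 'd piece) list"

fun ins :: "'d piece \<Rightarrow> nat" where
  "ins (Cap d) = 0"
| "ins Cup = 2"
| "ins (Cross s) = 2"

fun outs :: "'d piece \<Rightarrow> nat" where
  "outs (Cap d) = 2"
| "outs Cup = 0"
| "outs (Cross s) = 2"

definition forget_orientation :: "'d diagram \<Rightarrow> unit diagram" where
  "forget_orientation D = map (map_prod id (map_piece (\<lambda>_. ()))) D"

text \<open>
  \<open>through D xs\<close> is the list of strand directions below \<open>D\<close>, given the directions \<open>xs\<close> above it;
  it is \<open>None\<close> if a piece does not fit or a cup joins two strands of equal direction.
\<close>

fun through_slice :: "nat \<times> bool piece \<Rightarrow> bool list \<Rightarrow> bool list option" where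
  "through_slice (i, Cap d) xs =
     (if i \<le> length xs then Some (take i xs @ [d, \<not> d] @ drop i xs) else None)"
| "through_slice (i, Cup) xs =
     (if i + 1 < length xs \<and> xs ! i \<noteq> xs ! (i + 1)
      then Some (take i xs @ drop (i + 2) xs) else None)"
| "through_slice (i, Cross s) xs =
     (if i + 1 < length xs
      then Some (take i xs @ [xs ! (i + 1), xs ! i] @ drop (i + 2) xs) else None)"

fun through :: "bool diagram \<Rightarrow> bool list \<Rightarrow> bool list option" where
  "through [] xs = Some xs"
| "through (p # D) xs = Option.bind (through_slice p xs) (through D)"

definition link_diagram :: "bool diagram \<Rightarrow> bool" where
  "link_diagram D \<longleftrightarrow> through D [] = Some []"

definition orientation_of :: "bool diagram \<Rightarrow> unit diagram \<Rightarrow> bool" where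
  "orientation_of D U \<longleftrightarrow> link_diagram D \<and> forget_orientation D = U"

text \<open>
  Number of closed curves: sweeping downwards, \<open>xs\<close> labels the strands by the component they belong
  to as far as visible, and \<open>n\<close> is the next fresh label.  A cup either closes a component or merges
  two labels.
\<close>

fun closed_curves :: "nat \<Rightarrow> nat list \<Rightarrow> 'd diagram \<Rightarrow> nat" where
  "closed_curves n xs [] = 0"
| "closed_curves n xs ((i, Cap d) # D) =
     closed_curves (n + 1) (take i xs @ [n, n] @ drop i xs) D"
| "closed_curves n xs ((i, Cup) # D) =
     (let ys = take i xs @ drop (i + 2) xs in
      if xs ! i = xs ! (i + 1) then 1 + closed_curves n ys D
      else closed_curves n (map (\<lambda>x. if x = xs ! (i + 1) then xs ! i else x) ys) D)"
| "closed_curves n xs ((i, Cross s) # D) =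
     closed_curves n (take i xs @ [xs ! (i + 1), xs ! i] @ drop (i + 2) xs) D"

definition components :: "'d diagram \<Rightarrow> nat" where
  "components D = closed_curves 0 [] D"

definition knot_diagram :: "bool diagram \<Rightarrow> bool" where
  "knot_diagram D \<longleftrightarrow> link_diagram D \<and> components D = 1"

text \<open>
  Isotopy of oriented links is the equivalence relation generated by planar isotopy (exchange of
  distant pieces, straightening of zigzags, sliding a strand past a cap or cup) and the
  Reidemeister moves, in the form of Turaev's moves for sliced diagrams.  The remaining variants
  (other curls, other crossing signs in the third move) follow from the ones listed.
\<close>

inductive local_move :: "'d diagram \<Rightarrow> 'd diagram \<Rightarrow> bool" where
  exchange: "local_move [(i, g), (i + outs g + k, h)] [(i + ins g + k, h), (i, g)]"
| zigzag_left: "local_move [(i + 1, Cap d), (i, Cup)] []"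
| zigzag_right: "local_move [(i, Cap d), (i + 1, Cup)] []"
| slide_cap: "local_move [(i, Cap d), (i + 1, Cross s)] [(i + 1, Cap d), (i, Cross (\<not> s))]"
| slide_cup: "local_move [(i + 1, Cross s), (i, Cup)] [(i, Cross (\<not> s)), (i + 1, Cup)]"
| reidemeister1: "local_move [(i + 1, Cap d), (i, Cross s), (i + 1, Cup)] []"
| reidemeister2: "local_move [(i, Cross s), (i, Cross (\<not> s))] []"
| reidemeister3: "local_move [(i, Cross s), (i + 1, Cross s), (i, Cross s)]
                             [(i + 1, Cross s), (i, Cross s), (i + 1, Cross s)]"

definition diagram_move :: "bool diagram \<Rightarrow> bool diagram \<Rightarrow> bool" where
  "diagram_move D E \<longleftrightarrow> link_diagram D \<and> link_diagram E \<and>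
     (\<exists>U l r V. local_move l r \<and> D = U @ l @ V \<and> E = U @ r @ V)"

definition isotopic :: "bool diagram \<Rightarrow> bool diagram \<Rightarrow> bool" where
  "isotopic = equivclp diagram_move"

text \<open>
  Sign of a slice with strand directions \<open>xs\<close> above it: \<open>Cross True\<close> is right-handed (positive) iff
  its strands both point downwards or both upwards.
\<close>

fun crossing_sign :: "bool list \<Rightarrow> nat \<times> 'd piece \<Rightarrow> int" where
  "crossing_sign xs (i, Cross s) = (if (xs ! i = xs ! (i + 1)) = s then 1 else - 1)"
| "crossing_sign xs (i, Cap d) = 0"
| "crossing_sign xs (i, Cup) = 0"

fun writhe_below :: "bool list \<Rightarrow> bool diagram \<Rightarrow> int" where
  "writhe_below xs [] = 0"
| "writhe_below xs (p # D) =
     crossing_sign xs p + (case through_slice p xs of None \<Rightarrow> 0 | Some ys \<Rightarrow> writhe_below ys D)"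

definition writhe :: "bool diagram \<Rightarrow> int" where
  "writhe D = writhe_below [] D"

subsection \<open>HOMFLY polynomial\<close>

text \<open>\<open>\<int>[a\<^sup>\<plusminus>\<^sup>1, m\<^sup>\<plusminus>\<^sup>1]\<close> as the group ring of \<open>\<int>\<^sup>2\<close>: the exponent \<open>(i, j)\<close> stands for \<open>a\<^sup>i m\<^sup>j\<close>.\<close>

type_synonym laurent2 = "(int \<times> int) \<Rightarrow>\<^sub>0 int"

definition oriented_smoothing :: "bool list \<Rightarrow> nat \<Rightarrow> bool diagram" where
  "oriented_smoothing xs i =
     (if xs ! i = xs ! (i + 1) then [] else [(i, Cup), (i, Cap (xs ! (i + 1)))])"

definition skein_triple :: "bool diagram \<Rightarrow> bool diagram \<Rightarrow> bool diagram \<Rightarrow> bool" where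
  "skein_triple Lp Lm L0 \<longleftrightarrow> link_diagram Lp \<and>
     (\<exists>U V xs i s. through U [] = Some xs \<and> crossing_sign xs (i, Cross s :: bool piece) = 1 \<and>
        Lp = U @ [(i, Cross s)] @ V \<and>
        Lm = U @ [(i, Cross (\<not> s))] @ V \<and>
        L0 = U @ oriented_smoothing xs i @ V)"

definition homfly_polynomial :: "(bool diagram \<Rightarrow> laurent2) \<Rightarrow> bool" where
  "homfly_polynomial P \<longleftrightarrow>
     (\<forall>D E. isotopic D E \<longrightarrow> P D = P E) \<and>
     (\<forall>d. P [(0, Cap d), (0, Cup)] = 1) \<and>
     (\<forall>Lp Lm L0. skein_triple Lp Lm L0 \<longrightarrow>
        Poly_Mapping.single (1, 0) 1 * P Lp + Poly_Mapping.single (- 1, 0) 1 * P Lm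
          + Poly_Mapping.single (0, 1) 1 * P L0 = 0)"

subsection \<open>Jones polynomial\<close>

type_synonym laurent = "int \<Rightarrow>\<^sub>0 int"

text \<open>
  The Kauffman states of a diagram, each with the number of A-smoothings minus the number of
  B-smoothings.  The A-smoothing of \<open>Cross True\<close> consists of two vertical strands.
\<close>

fun kauffman_states :: "unit diagram \<Rightarrow> (int \<times> unit diagram) list" where
  "kauffman_states [] = [(0, [])]"
| "kauffman_states ((i, Cross s) # D) =
     (let e = (if s then 1 else - 1) in
      map (\<lambda>(k, S). (k + e, S)) (kauffman_states D) @
      map (\<lambda>(k, S). (k - e, (i, Cup) # (i, Cap ()) # S)) (kauffman_states D))"
| "kauffman_states ((i, Cap d) # D) = map (\<lambda>(k, S). (k, (i, Cap d) # S)) (kauffman_states D)"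
| "kauffman_states ((i, Cup) # D) = map (\<lambda>(k, S). (k, (i, Cup) # S)) (kauffman_states D)"

definition kauffman_bracket :: "unit diagram \<Rightarrow> laurent" where
  "kauffman_bracket D = (\<Sum>(k, S) \<leftarrow> kauffman_states D. Poly_Mapping.single k 1 *
     (- Poly_Mapping.single 2 1 - Poly_Mapping.single (- 2) 1) ^ (components S - 1))"

text \<open>
  \<open>(-A\<^sup>3)\<^sup>-\<^sup>w \<langle>D\<rangle>\<close> with \<open>w\<close> the writhe, followed by the substitution \<open>A = t\<^sup>-\<^sup>1\<^sup>/\<^sup>4\<close>; the exponent \<open>n\<close>
  in the result stands for \<open>t\<^sup>n\<^sup>/\<^sup>4\<close>.
\<close>

definition jones_polynomial :: "bool diagram \<Rightarrow> laurent" where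
  "jones_polynomial D = Poly_Mapping.map_key uminus
     (Poly_Mapping.single (- 3 * writhe D) (if even (writhe D) then 1 else - 1)
        * kauffman_bracket (forget_orientation D))"

subsection \<open>Plats, bridge number, connected sum\<close>

text \<open>A braid word is a list of letters \<open>(i, s)\<close>: a crossing of the positions \<open>i\<close> and \<open>i + 1\<close>.\<close>

type_synonym braid_word = "(nat \<times> bool) list"

definition sigma_power :: "nat \<Rightarrow> int \<Rightarrow> braid_word" where
  "sigma_power i k = replicate (nat \<bar>k\<bar>) (i, k > 0)"

definition plat :: "nat \<Rightarrow> braid_word \<Rightarrow> unit diagram" where
  "plat n w = map (\<lambda>k. (2 * k, Cap ())) [0..<n] @ map (\<lambda>(i, s). (i, Cross s)) w
     @ map (\<lambda>k. (2 * k, Cup)) (rev [0..<n])"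

definition has_plat_presentation :: "bool diagram \<Rightarrow> nat \<Rightarrow> bool" where
  "has_plat_presentation K n \<longleftrightarrow>
     (\<exists>w E. (\<forall>(i, s) \<in> set w. i + 1 < 2 * n) \<and> orientation_of E (plat n w) \<and> isotopic E K)"

definition bridge_number :: "bool diagram \<Rightarrow> nat" where
  "bridge_number K = (LEAST n. has_plat_presentation K n)"

definition bridge_knot :: "nat \<Rightarrow> bool diagram \<Rightarrow> bool" where
  "bridge_knot n K \<longleftrightarrow> knot_diagram K \<and> bridge_number K = n"

text \<open>
  A nonempty closed diagram starts with a cap and ends with a cup, both at position 0.  The connected
  sum puts \<open>D\<close> above \<open>E\<close> and joins the two strands at the last cup of \<open>D\<close> to those at the first cap
  of \<open>E\<close>.  The result is a link diagram provided the directions of these strands agree.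
\<close>

definition connected_sum :: "bool diagram \<Rightarrow> bool diagram \<Rightarrow> bool diagram" where
  "connected_sum D E = butlast D @ tl E"

definition knot_8_9 :: "unit diagram" where
  "knot_8_9 = plat 2 (sigma_power 1 (- 3) @ sigma_power 2 1 @ sigma_power 1 (- 1)
     @ sigma_power 2 2 @ sigma_power 1 (- 1))"

definition knot_4_1 :: "unit diagram" where
  "knot_4_1 = plat 2 (sigma_power 1 (- 1) @ sigma_power 2 1 @ sigma_power 1 (- 2))"

end

theory Submission
  imports Defs "HOL-Library.Numeral_Type"
begin

text \<open>
  Bridge numbers: the number of Fox 5-colourings is an isotopy invariant, and a plat on \<open>2 n\<close>
  strings has at most \<open>5 ^ n\<close> of them because the colours of its \<open>n\<close> caps determine the rest.
  The knot \<open>8_9\<close> has 25 colourings and the sum of two figure-eight knots has 125.  An explicit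
  isotopy pushes the inner cap of the sum up and its inner cup down, giving a plat on 6 strings.

  HOMFLY: changing the first \<open>\<sigma>\<^sub>2\<close> of \<open>8_9\<close> gives the unknot, and smoothing it gives a connected sum
  of a trefoil and a parallel (2,4) torus link; on twist regions of parallel strands the skein
  relation is a linear recursion.  Hence \<open>P(8_9)\<close> has a term \<open>m\<^sup>6\<close>, whereas \<open>P(4_1)\<close> has degree 2
  in \<open>m\<close> and enters squared.
\<close>

section \<open>Diagrams of the two knots\<close>

abbreviation (input) braid_4_1 :: "'d diagram" where
  "braid_4_1 \<equiv> [(1, Cross False), (2, Cross True), (1, Cross False), (1, Cross False)]"

abbreviation (input) braid_8_9 :: "'d diagram" where
  "braid_8_9 \<equiv> [(1, Cross False), (1, Cross False), (1, Cross False), (2, Cross True),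
     (1, Cross False), (2, Cross True), (2, Cross True), (1, Cross False)]"

definition oriented_8_9 :: "bool \<Rightarrow> bool diagram" where
  "oriented_8_9 d = (0, Cap d) # (2, Cap (\<not> d)) # braid_8_9 @ [(2, Cup), (0, Cup)]"

definition oriented_4_1 :: "bool \<Rightarrow> bool diagram" where
  "oriented_4_1 d = (0, Cap d) # (2, Cap (\<not> d)) # braid_4_1 @ [(2, Cup), (0, Cup)]"

definition oriented_sum :: "bool \<Rightarrow> bool diagram" where
  "oriented_sum d = (0, Cap d) # (2, Cap (\<not> d)) # braid_4_1
     @ [(2, Cup), (2, Cap (\<not> d))] @ braid_4_1 @ [(2, Cup), (0, Cup)]"

lemma forget_orientation_eq_Cons:
  "forget_orientation K = (i, p) # D \<longleftrightarrow>
    (\<exists>q K'. K = (i, q) # K' \<and> map_piece (\<lambda>_. ()) q = p \<and> forget_orientation K' = D)"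
  by (cases K) (auto simp: forget_orientation_def)

lemma forget_orientation_eq_Nil: "forget_orientation K = [] \<longleftrightarrow> K = []"
  by (simp add: forget_orientation_def)

lemma map_piece_eq:
  "map_piece f q = Cup \<longleftrightarrow> q = Cup" "map_piece f q = Cross s \<longleftrightarrow> q = Cross s"
  "map_piece (\<lambda>_. ()) q = Cap () \<longleftrightarrow> (\<exists>d. q = Cap d)"
  by (cases q; auto)+

lemma knot_8_9_eq: "knot_8_9 = (0, Cap ()) # (2, Cap ()) # braid_8_9 @ [(2, Cup), (0, Cup)]"
  by code_simp

lemma knot_4_1_eq: "knot_4_1 = (0, Cap ()) # (2, Cap ()) # braid_4_1 @ [(2, Cup), (0, Cup)]"
  by code_simp

text \<open>A cup joins only strands of opposite directions, which forces the two caps to carry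
  opposite labels; only reversal of the whole knot remains free.\<close>

lemma orientation_8_9:
  assumes "orientation_of K knot_8_9"
  obtains d where "K = oriented_8_9 d"
proof -
  obtain d e where K: "K = (0, Cap d) # (2, Cap e) # braid_8_9 @ [(2, Cup), (0, Cup)]"
    using assms
    unfolding orientation_of_def knot_8_9_eq append_Cons append_Nil forget_orientation_eq_Cons
      forget_orientation_eq_Nil map_piece_eq
    by blast
  then have "e = (\<not> d)"
    using assms by (cases d; cases e) (simp_all add: orientation_of_def link_diagram_def)
  with K that show ?thesis
    by (simp add: oriented_8_9_def)
qed

lemma orientation_4_1:
  assumes "orientation_of D knot_4_1"
  obtains d where "D = oriented_4_1 d"
proof -
  obtain d e where D: "D = (0, Cap d) # (2, Cap e) # braid_4_1 @ [(2, Cup), (0, Cup)]"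
    using assms
    unfolding orientation_of_def knot_4_1_eq append_Cons append_Nil forget_orientation_eq_Cons
      forget_orientation_eq_Nil map_piece_eq
    by blast
  then have "e = (\<not> d)"
    using assms by (cases d; cases e) (simp_all add: orientation_of_def link_diagram_def)
  with D that show ?thesis
    by (simp add: oriented_4_1_def)
qed

lemma connected_sum_4_1: "connected_sum (oriented_4_1 d) (oriented_4_1 d) = oriented_sum d"
  by (simp add: connected_sum_def oriented_4_1_def oriented_sum_def)

lemma knot_diagram_8_9: "knot_diagram (oriented_8_9 d)"
  by (cases d) (simp_all add: oriented_8_9_def knot_diagram_def link_diagram_def components_def)

lemma knot_diagram_sum: "knot_diagram (oriented_sum d)"
  by (cases d) (simp_all add: oriented_sum_def knot_diagram_def link_diagram_def components_def)

section \<open>Colourings\<close>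

lemma through_append: "through (S @ T) xs = Option.bind (through S xs) (through T)"
  by (induction S arbitrary: xs) (auto split: bind_split)

text \<open>
  Fox colourings: at a crossing the over-strand keeps its colour and the under-strand is reflected
  in it.  \<open>F\<close> counts the colourings of the rest of the diagram, as a function of the colours below
  the piece; in \<open>colourings D xs\<close> the colours above \<open>D\<close> are prescribed to be \<open>xs\<close>.
\<close>

fun colour_piece :: "'d piece \<Rightarrow> 'a::{finite,comm_ring_1} list \<Rightarrow> ('a list \<Rightarrow> nat) \<Rightarrow> nat" where
  "colour_piece (Cap d) ms F = (\<Sum>c\<in>UNIV. F [c, c])"
| "colour_piece Cup ms F = (if ms ! 0 = ms ! 1 then F [] else 0)"
| "colour_piece (Cross s) ms F =
     F (if s then [ms ! 1, 2 * ms ! 1 - ms ! 0] else [2 * ms ! 0 - ms ! 1, ms ! 0])"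

fun colourings :: "'d diagram \<Rightarrow> 'a::{finite,comm_ring_1} list \<Rightarrow> nat" where
  "colourings [] xs = of_bool (xs = [])"
| "colourings ((i, g) # D) xs = colour_piece g (take (ins g) (drop i xs))
     (\<lambda>ms. colourings D (take i xs @ ms @ drop (i + ins g) xs))"

declare colourings.simps(2) [simp del]

lemma colourings_slice:
  assumes "length A = i" and "length ms = ins g"
  shows "colourings ((i, g) # D) (A @ ms @ C) = colour_piece g ms (\<lambda>ns. colourings D (A @ ns @ C))"
  using assms by (simp add: colourings.simps(2))

lemma colourings_cap:
  assumes "length A = i"
  shows "colourings ((i, Cap d) # D) (A @ C) = (\<Sum>c\<in>UNIV. colourings D (A @ c # c # C))"
  using colourings_slice[OF assms, of "[]" "Cap d" D C] by simp

lemma colourings_cup: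
  assumes "length A = i"
  shows "colourings ((i, Cup) # D) (A @ x # y # C) = (if x = y then colourings D (A @ C) else 0)"
  using colourings_slice[OF assms, of "[x, y]" Cup D C] by simp

lemma colourings_cross:
  assumes "length A = i"
  shows "colourings ((i, Cross s) # D) (A @ x # y # C) =
    colourings D (if s then A @ y # (2 * y - x) # C else A @ (2 * x - y) # x # C)"
  using colourings_slice[OF assms, of "[x, y]" "Cross s" D C] by simp

lemma colourings_cup_Suc:
  assumes "length A = i"
  shows "colourings ((Suc i, Cup) # D) (A @ w # x # y # C) =
    (if x = y then colourings D (A @ w # C) else 0)"
  using colourings_cup[of "A @ [w]" "Suc i" D x y C] assms by simp

lemma colourings_cross_Suc:
  assumes "length A = i"
  shows "colourings ((Suc i, Cross s) # D) (A @ w # x # y # C) =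
    colourings D (if s then A @ w # y # (2 * y - x) # C else A @ w # (2 * x - y) # x # C)"
  using colourings_cross[of "A @ [w]" "Suc i" s D x y C] assms by simp

lemma colourings_cap_Suc:
  assumes "length A = i"
  shows "colourings ((Suc i, Cap d) # D) (A @ w # C) =
    (\<Sum>c\<in>UNIV. colourings D (A @ w # c # c # C))"
  using colourings_cap[of "A @ [w]" "Suc i" d D C] assms by simp

lemma colour_piece_commute:
  "colour_piece g ms (\<lambda>ms'. colour_piece h ns (F ms')) =
   colour_piece h ns (\<lambda>ns'. colour_piece g ms (\<lambda>ms'. F ms' ns'))"
  by (cases g; cases h) (auto intro: sum.swap)

lemma through_slice_length:
  "through_slice (i, g) xs = Some ys \<Longrightarrow> i + ins g \<le> length xs \<and> length ys + ins g = length xs + outs g"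
  by (cases g) (auto split: if_splits)

lemma split_list_at:
  assumes "i + n \<le> length xs"
  obtains A ms C where "xs = A @ ms @ C" "length A = i" "length ms = n"
proof
  show "xs = take i xs @ take n (drop i xs) @ drop n (drop i xs)"
    by (simp only: append_take_drop_id)
qed (use assms in auto)

lemma split_list_at1:
  assumes "i < length xs"
  obtains A x C where "xs = A @ x # C" "length A = i"
  using assms id_take_nth_drop[OF assms] by force

lemma split_list_at2:
  assumes "Suc i < length xs"
  obtains A x y C where "xs = A @ x # y # C" "length A = i"
proof -
  obtain A ms C where "xs = A @ ms @ C" "length A = i" "length ms = Suc (Suc 0)"
    using split_list_at[of i "Suc (Suc 0)" xs] assms by auto
  then show ?thesis
    using that by (auto simp: length_Suc_conv)
qed

lemma split_list_at3:
  assumes "Suc (Suc i) < length xs"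
  obtains A x y z C where "xs = A @ x # y # z # C" "length A = i"
proof -
  obtain A ms C where "xs = A @ ms @ C" "length A = i" "length ms = Suc (Suc (Suc 0))"
    using split_list_at[of i "Suc (Suc (Suc 0))" xs] assms by auto
  then show ?thesis
    using that by (auto simp: length_Suc_conv)
qed

lemmas colourings_simps = colourings_cap colourings_cup colourings_cross
  colourings_cap_Suc colourings_cup_Suc colourings_cross_Suc

text \<open>The directions \<open>ys\<close> guarantee that the pieces of \<open>l\<close> find
  enough strands in \<open>xs\<close>; each move is then a short computation with
  reflections.\<close>

lemma colourings_local_move:
  fixes xs :: "'a::{finite,comm_ring_1} list"
  assumes "local_move l r" and "through l ys \<noteq> None" and "length xs = length ys"
  shows "colourings (l @ D) xs = colourings (r @ D) xs"
  using assms
proof (induction rule: local_move.induct)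
  case (exchange i g k h)
  then obtain ys' zs where "through_slice (i, g) ys = Some ys'"
    "through_slice (i + outs g + k, h) ys' = Some zs"
    by (auto simp: bind_eq_Some_conv)
  then have "i + ins g + (k + ins h) \<le> length xs"
    using through_slice_length[of i g ys ys'] through_slice_length[of "i + outs g + k" h ys' zs]
      exchange by linarith
  then obtain B ns C where xs: "xs = B @ ns @ C" "length B = i + ins g + k" "length ns = ins h"
    using split_list_at[of "i + ins g + k" "ins h" xs] by (auto simp: algebra_simps)
  obtain A ms M where B: "B = A @ ms @ M" "length A = i" "length ms = ins g"
    using split_list_at[of i "ins g" B] xs by auto
  have M: "length M = k"
    using xs B by simp
  \<comment> \<open>\<open>colour_piece g ms\<close> evaluates its continuation only at lists of
    length \<open>outs g\<close>, which puts \<open>h\<close> at the right index below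
    \<open>g\<close>.\<close>
  have len: "colour_piece g ms F = colour_piece g ms F'"
    if "\<And>ms'. length ms' = outs g \<Longrightarrow> F ms' = F' ms'" for F F'
    using that by (cases g) (auto intro: sum.cong)
  have "colourings ([(i, g), (i + outs g + k, h)] @ D) xs =
    colour_piece g ms (\<lambda>ms'. colourings ((i + outs g + k, h) # D) (A @ ms' @ M @ ns @ C))"
    using colourings_slice[of A i ms g _ "M @ ns @ C"] B xs by simp
  also have "\<dots> = colour_piece g ms (\<lambda>ms'. colour_piece h ns (\<lambda>ns'. colourings D (A @ ms' @ M @ ns' @ C)))"
    using B M xs colourings_slice[of "A @ _ @ M" "i + outs g + k" ns h D C] by (intro len) simp
  also have "\<dots> = colour_piece h ns (\<lambda>ns'. colour_piece g ms (\<lambda>ms'. colourings D (A @ ms' @ M @ ns' @ C)))"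
    by (rule colour_piece_commute)
  also have "\<dots> = colourings ([(i + ins g + k, h), (i, g)] @ D) xs"
    using colourings_slice[of B "i + ins g + k" ns h _ C] colourings_slice[of A i ms g D "M @ _ @ C"] B xs
    by simp
  finally show ?case .
next
  case (zigzag_left i d)
  then obtain A x C where "xs = A @ x # C" "length A = i"
    using split_list_at1[of i xs] by (auto split: if_splits)
  then show ?case
    by (simp add: colourings_simps)
next
  case (zigzag_right i d)
  then obtain A x C where "xs = A @ x # C" "length A = i"
    using split_list_at1[of i xs] by (auto split: if_splits)
  then show ?case
    by (simp add: colourings_simps)
next
  case (slide_cap i d s)
  then obtain A x C where "xs = A @ x # C" "length A = i"
    using split_list_at1[of i xs] by (auto split: if_splits)
  \<comment> \<open>If the strand of the cap passes under, sliding it across \<open>x\<close>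
    reflects its colour in \<open>x\<close>, an involution of the summation range.\<close>
  then show ?case
    by (cases s) (auto simp: colourings_simps
        intro!: sum.reindex_bij_witness[of _ "\<lambda>c. 2 * x - c" "\<lambda>c. 2 * x - c"])
next
  case (slide_cup i s)
  then obtain A x y z C where "xs = A @ x # y # z # C" "length A = i"
    using split_list_at3[of i xs] by (auto split: if_splits)
  then show ?case
    by (cases s) (auto simp: colourings_simps algebra_simps)
next
  case (reidemeister1 i d s)
  then obtain A x C where xs: "xs = A @ x # C" "length A = i"
    using split_list_at1[of i xs] by (auto split: if_splits)
  \<comment> \<open>The curl is forced to have the colour of the strand, so one term of the sum
    survives.\<close>
  have "2 * c - x = c \<longleftrightarrow> x = c" for c
    by (auto simp: algebra_simps)
  then show ?case
    using xs by (cases s) (simp_all add: colourings_simps)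
next
  case (reidemeister2 i s)
  then obtain A x y C where "xs = A @ x # y # C" "length A = i"
    using split_list_at2[of i xs] by (auto split: if_splits)
  then show ?case
    by (cases s) (simp_all add: colourings_simps)
next
  case (reidemeister3 i s)
  then have "Suc (Suc i) < length xs"
    by (auto split: if_splits)
  then obtain A x y z C where "xs = A @ x # y # z # C" "length A = i"
    by (rule split_list_at3)
  then show ?case
    by (cases s) (simp_all add: colourings_simps algebra_simps)
qed

text \<open>Equality of the counts below \<open>U\<close>, for all colours there, lifts through
  \<open>U\<close> slice by slice; \<open>zs\<close> and \<open>ys\<close> record the numbers of
  strands.\<close>

lemma colourings_prefix:
  fixes xs :: "'a::{finite,comm_ring_1} list"
  assumes "through U zs = Some ys" and "length xs = length zs"
    and "\<And>xs :: 'a list. length xs = length ys \<Longrightarrow> colourings D xs = colourings E xs"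
  shows "colourings (U @ D) xs = colourings (U @ E) xs"
  using assms(1,2)
proof (induction U arbitrary: zs xs)
  case Nil
  then show ?case
    using assms(3) by simp
next
  case (Cons p U)
  obtain i g where p: "p = (i, g)"
    by (cases p)
  obtain ws where ws: "through_slice (i, g) zs = Some ws" "through U ws = Some ys"
    using Cons.prems p by (auto simp: bind_eq_Some_conv)
  obtain A ms C where xs: "xs = A @ ms @ C" "length A = i" "length ms = ins g"
    using split_list_at through_slice_length[OF ws(1)] Cons.prems(2) by metis
  have IH: "colourings (U @ D) (A @ ns @ C) = colourings (U @ E) (A @ ns @ C)"
    if "length ns = outs g" for ns
    using Cons.IH[OF ws(2)] through_slice_length[OF ws(1)] xs that Cons.prems(2) by auto
  show ?case
  proof (cases g)
    case (Cap d)
    then have "colourings (U @ D) (A @ c # c # C) = colourings (U @ E) (A @ c # c # C)" for c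
      using IH[of "[c, c]"] by simp
    then show ?thesis
      using xs Cap by (simp add: p colourings_cap)
  qed (use xs IH in \<open>simp_all add: p colourings_slice\<close>)
qed

lemma colourings_diagram_move:
  assumes "diagram_move D E"
  shows "colourings D ([] :: 'a::{finite,comm_ring_1} list) = colourings E ([] :: 'a list)"
proof -
  obtain U l r V where *: "local_move l r" "D = U @ l @ V" "E = U @ r @ V" "link_diagram D"
    using assms unfolding diagram_move_def by blast
  obtain ys where ys: "through U [] = Some ys" "through l ys \<noteq> None"
    using * by (auto simp: link_diagram_def through_append bind_eq_Some_conv)
  show ?thesis
    unfolding * by (rule colourings_prefix[OF ys(1)]) (use colourings_local_move[OF *(1) ys(2)] in auto)
qed

lemma colourings_isotopic:
  assumes "isotopic D E"
  shows "colourings D ([] :: 'a::{finite,comm_ring_1} list) = colourings E ([] :: 'a list)"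
  using assms unfolding isotopic_def
  by (induction rule: equivclp_induct) (auto dest: colourings_diagram_move[where 'a = 'a])

section \<open>Plats and the lower bound for the bridge number\<close>

fun is_cap :: "nat \<times> 'd piece \<Rightarrow> bool" where
  "is_cap (i, Cap d) = True"
| "is_cap p = False"

text \<open>A colour is chosen only at a cap; a crossing determines the colours below it and a cup
  merely tests an equality.\<close>

lemma colourings_le:
  fixes xs :: "'a::{finite,comm_ring_1} list"
  shows "colourings D xs \<le> CARD('a) ^ length (filter is_cap D)"
proof (induction D arbitrary: xs)
  case (Cons p D)
  obtain i g where p: "p = (i, g)"
    by (cases p)
  show ?case
  proof (cases g)
    case (Cap d)
    then show ?thesis
      using sum_bounded_above[of UNIV "\<lambda>c. colourings D (take i xs @ c # c # drop i xs)"] Cons.IH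
      by (simp add: p colourings.simps(2))
  qed (use Cons.IH in \<open>auto simp: p colourings.simps(2)\<close>)
qed simp

lemma is_cap_map_prod [simp]: "is_cap (map_prod id (map_piece f) p) = is_cap p"
  by (cases p rule: is_cap.cases) auto

lemma caps_plat: "length (filter is_cap (plat n w)) = n"
proof -
  have "filter is_cap (map (\<lambda>(i, s). (i, Cross s)) w) = ([] :: unit diagram)"
    by (induction w) auto
  moreover have "filter is_cap (map (\<lambda>k. (2 * k, Cup)) ks) = ([] :: unit diagram)" for ks
    by (induction ks) auto
  moreover have "filter is_cap (map (\<lambda>k. (2 * k, Cap ())) ks) = map (\<lambda>k. (2 * k, Cap ())) ks" for ks :: "nat list"
    by (induction ks) auto
  ultimately show ?thesis
    by (simp add: plat_def)
qed

lemma colourings_le_plat: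
  assumes "has_plat_presentation K n"
  shows "colourings K ([] :: 'a::{finite,comm_ring_1} list) \<le> CARD('a) ^ n"
proof -
  obtain w E where E: "forget_orientation E = plat n w" "isotopic E K"
    using assms by (auto simp: has_plat_presentation_def orientation_of_def)
  have "length (filter is_cap E) = length (filter is_cap (forget_orientation E))"
    by (simp add: forget_orientation_def filter_map comp_def)
  also have "\<dots> = n"
    by (simp add: E caps_plat)
  finally show ?thesis
    using colourings_le[of E "[] :: 'a list"] colourings_isotopic[OF E(2), where 'a = 'a] by simp
qed

text \<open>A plat on \<open>2 * k\<close> strings has at most \<open>CARD('a) ^ k\<close>
  colourings, so more than \<open>CARD('a) ^ n\<close> of them force \<open>k > n\<close>.\<close>

lemma bridge_numberI:
  assumes "has_plat_presentation K (Suc n)"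
    and "colourings K ([] :: 'a::{finite,comm_ring_1} list) > CARD('a) ^ n"
  shows "bridge_number K = Suc n"
  unfolding bridge_number_def
proof (rule Least_equality)
  fix k assume "has_plat_presentation K k"
  then have "CARD('a) ^ n < CARD('a) ^ k"
    using colourings_le_plat[of K k, where 'a = 'a] assms(2) by linarith
  then show "Suc n \<le> k"
    using power_increasing[of k n "CARD('a)"] by (force simp: not_less_eq_eq Suc_leI)
qed (fact assms(1))

text \<open>
  Cap-free diagrams act on colours of the form \<open>c + k t\<close> with \<open>c\<close>, \<open>t\<close> fixed through the
  coefficients \<open>k\<close> alone.
\<close>

fun affine_colours :: "'d diagram \<Rightarrow> int list \<Rightarrow> int list option" where
  "affine_colours [] ks = Some ks"
| "affine_colours ((i, Cap d) # D) ks = None"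
| "affine_colours ((i, Cup) # D) ks =
     (if i + 1 < length ks \<and> ks ! i = ks ! (i + 1)
      then affine_colours D (take i ks @ drop (i + 2) ks) else None)"
| "affine_colours ((i, Cross s) # D) ks =
     (if i + 1 < length ks
      then affine_colours D (take i ks @
        (if s then [ks ! (i + 1), (2 * ks ! (i + 1) - ks ! i) mod 5]
         else [(2 * ks ! i - ks ! (i + 1)) mod 5, ks ! i]) @ drop (i + 2) ks)
      else None)"

text \<open>Justifies reducing coefficients modulo 5, so that a cup can compare them as
  integers.\<close>

lemma of_int_mod_5: "(of_int (k mod 5) :: 5) = of_int k"
proof -
  have "(of_int k :: 5) = of_int (5 * (k div 5) + k mod 5)"
    by simp
  also have "\<dots> = 5 * of_int (k div 5) + of_int (k mod 5)"
    by (simp only: of_int_add of_int_mult of_int_numeral)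
  also have "(5 :: 5) = 0"
    by simp
  finally show ?thesis
    by (simp only: mult_zero_left add_0)
qed

text \<open>Reflection is affine:
  \<open>2 * (c + k * t) - (c + l * t) = c + (2 * k - l) * t\<close>. Equal coefficients at a cup
  give equal colours for all \<open>c\<close> and \<open>t\<close>.\<close>

lemma colourings_affine:
  fixes c t :: 5
  assumes "affine_colours D ks = Some ms"
  shows "colourings (D @ V) (map (\<lambda>k. c + of_int k * t) ks) =
    colourings V (map (\<lambda>k. c + of_int k * t) ms)"
  using assms
proof (induction D ks rule: affine_colours.induct)
  case (3 i D ks)
  then obtain A x y C where "ks = A @ x # y # C" "length A = i"
    using split_list_at2[of i ks] by (auto split: if_splits)
  with 3 show ?case
    by (auto simp: colourings_cup nth_append split: if_splits)
next
  case (4 i s D ks)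
  then obtain A x y C where "ks = A @ x # y # C" "length A = i"
    using split_list_at2[of i ks] by (auto split: if_splits)
  with 4 show ?case
    by (cases s) (auto simp: colourings_cross of_int_mod_5 nth_append algebra_simps split: if_splits)
qed auto

lemma colourings_cap_affine:
  fixes c :: 5
  assumes "affine_colours D [0, 0, 1, 1] = Some [0, 0]"
  shows "colourings ((2, Cap d) # D @ V) [c, c] = 5 * colourings V [c, c]"
proof -
  \<comment> \<open>With \<open>t = e - c\<close> the coefficients 0 and 1 stand for the colours
    \<open>c\<close> and \<open>e\<close>. So every colour \<open>e\<close> of the cap extends,
    whence the factor 5.\<close>
  have "colourings (D @ V) [c, c, e, e] = colourings V [c, c]" for e
    using colourings_affine[OF assms, of V c "e - c"] by simp
  then show ?thesis
    using colourings_cap[of "[c, c]" 2 d "D @ V" "[]"] by simp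
qed

lemma colourings_arc:
  "colourings ((2, Cap e) # braid_4_1 @ (2, Cup) # V) [c, c] = 5 * colourings V [c, c :: 5]"
  "colourings ((2, Cap e) # braid_8_9 @ (2, Cup) # V) [c, c] = 5 * colourings V [c, c :: 5]"
  using colourings_cap_affine[of "braid_4_1 @ [(2, Cup)]"]
    colourings_cap_affine[of "braid_8_9 @ [(2, Cup)]"]
  by simp_all

lemma colourings_closed:
  "colourings ((0, Cap d) # D) ([] :: 5 list) = (\<Sum>c\<in>UNIV. colourings D [c, c :: 5])"
  "colourings [(0, Cup)] [c, c :: 5] = 1"
  using colourings_cap[of "[] :: 5 list" 0 d D "[]"] colourings_cup[of "[]" 0 "[]" c c "[]"]
  by simp_all

lemma colourings_8_9: "colourings (oriented_8_9 d) ([] :: 5 list) = 25"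
  using colourings_arc(2)[of "\<not> d" "[(0, Cup)]"]
  by (simp add: oriented_8_9_def colourings_closed)

lemma colourings_sum: "colourings (oriented_sum d) ([] :: 5 list) = 125"
  using colourings_arc(1)[of "\<not> d" "[(0, Cup)]"]
    colourings_arc(1)[of "\<not> d" "(2, Cap (\<not> d)) # braid_4_1 @ [(2, Cup), (0, Cup)]"]
  by (simp add: oriented_sum_def colourings_closed)

section \<open>Isotopies of tangles\<close>

text \<open>A relative form of \<open>diagram_move\<close> for an open piece entered by strands of
  directions \<open>xs\<close>. The outgoing directions must agree, so that the piece can be
  replaced inside a larger diagram.\<close>

definition tangle_move :: "bool list \<Rightarrow> bool diagram \<Rightarrow> bool diagram \<Rightarrow> bool" where
  "tangle_move xs S T \<longleftrightarrow> through S xs \<noteq> None \<and> through S xs = through T xs \<and>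
     (\<exists>U l r V. local_move l r \<and> S = U @ l @ V \<and> T = U @ r @ V)"

definition tangle_isotopic :: "bool list \<Rightarrow> bool diagram \<Rightarrow> bool diagram \<Rightarrow> bool" where
  "tangle_isotopic xs = equivclp (tangle_move xs)"

lemma tangle_isotopic_trans:
  "tangle_isotopic xs R S \<Longrightarrow> tangle_isotopic xs S T \<Longrightarrow> tangle_isotopic xs R T"
  unfolding tangle_isotopic_def by (rule equivclp_trans)

lemma through_tangle_isotopic:
  "tangle_isotopic xs S T \<Longrightarrow> through S xs = through T xs"
  unfolding tangle_isotopic_def
  by (induction rule: equivclp_induct) (auto simp: tangle_move_def)

lemma isotopic_tangle:
  assumes "tangle_isotopic xs S T" and "through U [] = Some xs"
    and "through S xs = Some ys" and "through V ys = Some []"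
  shows "isotopic (U @ S @ V) (U @ T @ V)"
  using assms(1) unfolding tangle_isotopic_def
proof (induction rule: equivclp_induct)
  case base
  show ?case
    by (simp add: isotopic_def)
next
  case (step T T')
  have T: "through T xs = Some ys"
    using through_tangle_isotopic[of xs S T] step(1) assms(3) by (simp add: tangle_isotopic_def)
  have T': "through T' xs = Some ys"
    using step(2) T by (auto simp: tangle_move_def)
  \<comment> \<open>Stated for a general pair because the closure may run the step in either
    direction.\<close>
  have in_context: "diagram_move (U @ R @ V) (U @ R' @ V)"
    if move: "tangle_move xs R R'" and R: "through R xs = Some ys" for R R'
  proof -
    have R': "through R' xs = Some ys"
      using move R by (simp add: tangle_move_def)
    obtain A l r B where "local_move l r" "R = A @ l @ B" "R' = A @ r @ B"
      using move by (auto simp: tangle_move_def)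
    then have "\<exists>A l r B. local_move l r \<and> U @ R @ V = A @ l @ B \<and> U @ R' @ V = A @ r @ B"
      by (metis append.assoc)
    then show ?thesis
      using R R' assms(2,4) by (simp add: diagram_move_def link_diagram_def through_append)
  qed
  have "diagram_move (U @ T @ V) (U @ T' @ V) \<or> diagram_move (U @ T' @ V) (U @ T @ V)"
    using step(2) in_context[OF _ T] in_context[OF _ T'] by blast
  then show ?case
    using step(3) unfolding isotopic_def by (metis equivclp_into_equivclp)
qed

section \<open>Isotopies as checkable certificates\<close>

datatype move = Exchange nat "bool piece" nat "bool piece"
  | Zigzag_left nat bool | Zigzag_right nat bool
  | Slide_cap nat bool bool | Slide_cup nat bool
  | R1 nat bool bool | R2 nat bool | R3 nat bool

fun sides :: "move \<Rightarrow> bool diagram \<times> bool diagram" where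
  "sides (Exchange i g k h) = ([(i, g), (i + outs g + k, h)], [(i + ins g + k, h), (i, g)])"
| "sides (Zigzag_left i d) = ([(i + 1, Cap d), (i, Cup)], [])"
| "sides (Zigzag_right i d) = ([(i, Cap d), (i + 1, Cup)], [])"
| "sides (Slide_cap i d s) = ([(i, Cap d), (i + 1, Cross s)], [(i + 1, Cap d), (i, Cross (\<not> s))])"
| "sides (Slide_cup i s) = ([(i + 1, Cross s), (i, Cup)], [(i, Cross (\<not> s)), (i + 1, Cup)])"
| "sides (R1 i d s) = ([(i + 1, Cap d), (i, Cross s), (i + 1, Cup)], [])"
| "sides (R2 i s) = ([(i, Cross s), (i, Cross (\<not> s))], [])"
| "sides (R3 i s) = ([(i, Cross s), (i + 1, Cross s), (i, Cross s)],
     [(i + 1, Cross s), (i, Cross s), (i + 1, Cross s)])"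

lemma local_move_sides: "sides m = (l, r) \<Longrightarrow> local_move l r"
  by (cases m) (auto intro: local_move.intros local_move.intros[unfolded Suc_eq_plus1[symmetric]])

text \<open>
  A certificate for an isotopy is a list of steps \<open>(n, forward, m)\<close>: the move \<open>m\<close>, read from left
  to right iff \<open>forward\<close>, is applied to the slices starting at index \<open>n\<close>.
\<close>

fun apply_moves :: "bool list \<Rightarrow> (nat \<times> bool \<times> move) list \<Rightarrow> bool diagram \<Rightarrow> bool diagram option" where
  "apply_moves xs [] S = Some S"
| "apply_moves xs ((n, forward, m) # ms) S =
     (let (l, r) = (if forward then sides m else prod.swap (sides m));
          A = take n S; B = drop n S; T = A @ r @ drop (length l) B
      in if take (length l) B = l \<and> through S xs \<noteq> None \<and> through T xs = through S xs
         then apply_moves xs ms T else None)"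

text \<open>The tests in \<open>apply_moves\<close> make each step a \<open>tangle_move\<close> in
  one of its two directions; the steps are chained by transitivity.\<close>

lemma apply_moves_sound:
  "apply_moves xs ms S = Some T \<Longrightarrow> tangle_isotopic xs S T"
proof (induction xs ms S rule: apply_moves.induct)
  case (1 xs S)
  then show ?case
    by (simp add: tangle_isotopic_def)
next
  case (2 xs n forward m ms S)
  obtain l r where lr: "(if forward then sides m else prod.swap (sides m)) = (l, r)"
    by fastforce
  define R where "R = take n S @ r @ drop (length l) (drop n S)"
  have *: "take (length l) (drop n S) = l" "through S xs \<noteq> None" "through R xs = through S xs"
    "apply_moves xs ms R = Some T"
    using 2(2) lr by (auto simp: Let_def R_def split: if_splits)
  have S: "S = take n S @ l @ drop (length l) (drop n S)"
    using *(1) by (metis append_take_drop_id)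
  have "local_move l r \<or> local_move r l"
    using lr local_move_sides[of m] by (cases forward) (auto simp: prod.swap_def)
  then have "tangle_move xs S R \<or> tangle_move xs R S"
    using S * unfolding tangle_move_def R_def by metis
  then have "tangle_isotopic xs S R"
    unfolding tangle_isotopic_def by (metis equivclp_into_equivclp equivclp_refl)
  moreover have "tangle_isotopic xs R T"
    using 2(1)[OF refl lr[symmetric] refl refl R_def] * by simp
  ultimately show ?case
    by (rule tangle_isotopic_trans)
qed

text \<open>Sliding the cap turns the first crossing into one that cancels the second. The other two
  crossings are curls, and inserting a zigzag brings each into the form of
  \<open>reidemeister1\<close>.\<close>

lemma unknotted_4_1:
  "tangle_isotopic [d, \<not> d]
     [(2, Cap (\<not> d)), (1, Cross False), (2, Cross False), (1, Cross False), (1, Cross False),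
      (2, Cup)]
     []"
  by (rule apply_moves_sound[of _
    "[(0, False, Slide_cap 1 (\<not> d) True), (1, True, R2 2 True), (2, False, Zigzag_right 1 d),
      (1, False, Exchange 1 (Cap d) 0 (Cross False)),
      (0, False, Exchange 1 (Cap d) 0 (Cap (\<not> d))), (2, True, Slide_cup 2 False),
      (1, True, R1 2 (\<not> d) True), (2, False, Zigzag_right 1 (\<not> d)),
      (1, False, Exchange 1 (Cap (\<not> d)) 0 (Cross False)),
      (0, False, Exchange 1 (Cap (\<not> d)) 0 (Cap d)), (2, True, Slide_cup 2 False),
      (1, True, R1 2 d True), (0, True, Zigzag_right 1 (\<not> d))]"])
    (cases d; simp)

text \<open>The braid relation is used twice, each time exposing an inverse of
  \<open>\<sigma>\<^sub>2\<close> that cancels a \<open>\<sigma>\<^sub>2\<close>. The result is the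
  arc of \<open>unknotted_4_1\<close>.\<close>

lemma changed_8_9:
  "tangle_isotopic [d, \<not> d]
     [(2, Cap (\<not> d)), (1, Cross False), (1, Cross False), (1, Cross False), (2, Cross False),
      (1, Cross False), (2, Cross True), (2, Cross True), (1, Cross False), (2, Cup)]
     [(2, Cap (\<not> d)), (1, Cross False), (2, Cross False), (1, Cross False), (1, Cross False),
      (2, Cup)]"
  by (rule apply_moves_sound[of _
    "[(3, True, R3 1 False), (5, True, R2 2 False), (2, True, R3 1 False), (4, True, R2 2 False)]"])
    (cases d; simp)

text \<open>Sliding past the cap and the cup turns the outer crossings into
  \<open>\<sigma>\<^sub>2\<close>, so all four form one twist region.\<close>

lemma twist_region_4:
  "tangle_isotopic [d, \<not> d]
     [(2, Cap d), (1, Cross False), (2, Cross True), (2, Cross True), (1, Cross False), (2, Cup)]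
     [(1, Cap d), (2, Cross True), (2, Cross True), (2, Cross True), (2, Cross True), (1, Cup)]"
  by (rule apply_moves_sound[of _
    "[(0, False, Slide_cap 1 d True), (4, False, Slide_cup 1 True)]"])
    (cases d; simp)

text \<open>The curl slides around the cup to the other strand, where \<open>reidemeister1\<close> removes it.\<close>

lemma left_curl_True:
  "tangle_isotopic [d, \<not> d]
     [(1, Cap d), (2, Cross True), (1, Cup), (0, Cup)]
     [(0, Cup)]"
  by (rule apply_moves_sound[of _
    "[(1, True, Slide_cup 1 True), (2, False, Exchange 0 Cup 0 Cup), (1, True, Slide_cup 0 False),
      (0, True, R1 0 d True)]"])
    (cases d; simp)

lemma left_curl_False:
  "tangle_isotopic [d, \<not> d]
     [(1, Cap d), (2, Cross False), (1, Cup), (0, Cup)]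
     [(0, Cup)]"
  by (rule apply_moves_sound[of _
    "[(1, True, Slide_cup 1 False), (2, False, Exchange 0 Cup 0 Cup), (1, True, Slide_cup 0 True),
      (0, True, R1 0 d False)]"])
    (cases d; simp)

text \<open>A curl turns the circle into the figure eight
  \<open>[(2, Cap d), (2, Cross True), (2, Cup)]\<close>, with opposite directions at cap and cup;
  untwisting it from the other end leaves the circle reversed.\<close>

lemma circle_reverse:
  "tangle_isotopic [d, \<not> d]
     [(2, Cap d), (2, Cup)]
     [(2, Cap (\<not> d)), (2, Cup)]"
  by (rule apply_moves_sound[of _
    "[(1, False, R1 3 (\<not> d) False), (1, False, Slide_cap 3 (\<not> d) True),
      (3, False, Exchange 2 Cup 0 Cup), (2, False, Exchange 2 Cup 0 (Cross True)),
      (1, True, Zigzag_left 2 (\<not> d)), (2, False, Zigzag_right 2 (\<not> d)),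
      (1, False, Exchange 2 (Cap (\<not> d)) 0 (Cross True)),
      (0, False, Exchange 2 (Cap (\<not> d)) 0 (Cap d)), (2, True, Slide_cup 3 True),
      (1, True, R1 3 d False)]"])
    (cases d; simp)

lemma smoothed_clasp:
  "tangle_isotopic [d, \<not> d]
     [(2, Cap d), (1, Cup), (1, Cap d), (1, Cross False), (2, Cup)]
     []"
  by (rule apply_moves_sound[of _
    "[(0, True, Zigzag_left 1 d), (2, False, Zigzag_right 1 (\<not> d)),
      (1, False, Exchange 1 (Cap (\<not> d)) 0 (Cross False)),
      (0, False, Exchange 1 (Cap (\<not> d)) 0 (Cap d)), (2, True, Slide_cup 2 False),
      (1, True, R1 2 d True), (0, True, Zigzag_right 1 (\<not> d))]"])
    (cases d; simp)

text \<open>The cap rises freely to the right of the upper braid. The cup first crosses the two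
  strands on its right: \<open>reidemeister2\<close> and \<open>slide_cup\<close>, each used twice,
  take it from position 2 to 4 and leave the crossings at 3, 2, 4, 3. Then it sinks freely.\<close>

lemma connected_sum_plat:
  "tangle_isotopic [d, \<not> d]
     [(2, Cap (\<not> d)), (1, Cross False), (2, Cross True), (1, Cross False), (1, Cross False),
      (2, Cup), (2, Cap (\<not> d)), (1, Cross False), (2, Cross True), (1, Cross False),
      (1, Cross False), (2, Cup)]
     [(2, Cap (\<not> d)), (4, Cap (\<not> d)), (1, Cross False), (2, Cross True),
      (1, Cross False), (1, Cross False), (3, Cross False), (2, Cross False), (4, Cross False),
      (3, Cross False), (1, Cross False), (2, Cross True), (1, Cross False), (1, Cross False),
      (4, Cup), (2, Cup)]"
  by (rule apply_moves_sound[of _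
    "[(5, True, Exchange 2 Cup 0 (Cap (\<not> d))),
      (4, True, Exchange 1 (Cross False) 1 (Cap (\<not> d))),
      (3, True, Exchange 1 (Cross False) 1 (Cap (\<not> d))),
      (2, True, Exchange 2 (Cross True) 0 (Cap (\<not> d))),
      (1, True, Exchange 1 (Cross False) 1 (Cap (\<not> d))), (6, False, R2 3 False),
      (7, True, Slide_cup 2 True), (8, False, R2 4 False), (9, True, Slide_cup 3 True),
      (10, False, Exchange 1 (Cross False) 1 Cup), (11, False, Exchange 2 (Cross True) 0 Cup),
      (12, False, Exchange 1 (Cross False) 1 Cup),
      (13, False, Exchange 1 (Cross False) 1 Cup)]"])
    (cases d; simp)

section \<open>Bridge numbers of the two knots\<close>

lemma has_plat_presentation_8_9: "has_plat_presentation (oriented_8_9 d) 2"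
proof -
  let ?w = "sigma_power 1 (- 3) @ sigma_power 2 1 @ sigma_power 1 (- 1) @ sigma_power 2 2
    @ sigma_power 1 (- 1)"
  have "forget_orientation (oriented_8_9 d) = knot_8_9"
    unfolding knot_8_9_eq by (simp add: forget_orientation_def oriented_8_9_def)
  then have "orientation_of (oriented_8_9 d) (plat 2 ?w)"
    using knot_diagram_8_9[of d] by (simp add: orientation_of_def knot_diagram_def knot_8_9_def)
  moreover have "\<forall>(i, s) \<in> set ?w. i + 1 < 2 * 2"
    by (auto simp: sigma_power_def)
  ultimately show ?thesis
    unfolding has_plat_presentation_def by (metis isotopic_def equivclp_refl)
qed

lemma has_plat_presentation_sum: "has_plat_presentation (oriented_sum d) 3"
proof -
  let ?w = "[(1, False), (2, True), (1, False), (1, False), (3, False), (2, False), (4, False),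
    (3, False), (1, False), (2, True), (1, False), (1, False)] :: braid_word"
  let ?E = "(0, Cap d) # (2, Cap (\<not> d)) # (4, Cap (\<not> d)) # map (\<lambda>(i, s). (i, Cross s)) ?w
    @ [(4, Cup), (2, Cup), (0, Cup)]"
  have "isotopic (oriented_sum d) ?E"
    using isotopic_tangle[OF connected_sum_plat, of "[(0, Cap d)]" d "[d, \<not> d]" "[(0, Cup)]"]
    by (cases d) (simp_all add: oriented_sum_def)
  then have "isotopic ?E (oriented_sum d)"
    unfolding isotopic_def by (rule equivclp_sym)
  moreover have "link_diagram ?E"
    by (cases d) (simp_all add: link_diagram_def)
  moreover have "forget_orientation ?E = plat 3 ?w"
    by (simp add: forget_orientation_def plat_def upt_rec)
  moreover have "\<forall>(i, s) \<in> set ?w. i + 1 < 2 * 3"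
    by simp
  ultimately show ?thesis
    unfolding has_plat_presentation_def orientation_of_def by blast
qed

lemma bridge_knot_8_9: "bridge_knot 2 (oriented_8_9 d)"
  using bridge_numberI[of "oriented_8_9 d" 1, where 'a = 5] has_plat_presentation_8_9
  by (simp add: bridge_knot_def knot_diagram_8_9 colourings_8_9 numeral_2_eq_2)

lemma bridge_knot_sum: "bridge_knot 3 (oriented_sum d)"
  using bridge_numberI[of "oriented_sum d" 2, where 'a = 5] has_plat_presentation_sum
  by (simp add: bridge_knot_def knot_diagram_sum colourings_sum)

section \<open>HOMFLY polynomials\<close>

abbreviation a :: laurent2 where "a \<equiv> Poly_Mapping.single (1, 0) 1"
abbreviation a' :: laurent2 where "a' \<equiv> Poly_Mapping.single (- 1, 0) 1"
abbreviation m :: laurent2 where "m \<equiv> Poly_Mapping.single (0, 1) 1"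
abbreviation m' :: laurent2 where "m' \<equiv> Poly_Mapping.single (0, - 1) 1"

lemma solve_unit:
  fixes u v w x :: "'a::comm_ring_1"
  assumes "v * u = 1" and "u * x + w = 0"
  shows "x = - v * w"
proof -
  have "v * (u * x + w) = (v * u) * x + v * w"
    by (simp only: distrib_left mult.assoc)
  then show ?thesis
    using assms by (simp add: eq_neg_iff_add_eq_0)
qed

text \<open>As \<open>a\<close> and \<open>m\<close> are units, any two terms of a skein relation
  determine the third.\<close>

lemma skein_solve:
  fixes x y z :: laurent2
  assumes "a * x + a' * y + m * z = 0"
  shows "x = - a' * (a' * y + m * z)" and "y = - a * (a * x + m * z)" and "z = - m' * (a * x + a' * y)"
proof -
  have units: "a' * a = 1" "a * a' = 1" "m' * m = 1"
    by (simp_all add: Poly_Mapping.mult_single flip: zero_prod_def)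
  show "x = - a' * (a' * y + m * z)"
    using assms by (intro solve_unit[OF units(1)]) (simp only: ac_simps)
  show "y = - a * (a * x + m * z)"
    using assms by (intro solve_unit[OF units(2)]) (simp only: ac_simps)
  show "z = - m' * (a * x + a' * y)"
    using assms by (intro solve_unit[OF units(3)]) (simp only: ac_simps)
qed

text \<open>A window in a diagram: \<open>Q T\<close> is the polynomial with \<open>T\<close> placed
  between \<open>U\<close> and \<open>V\<close>. A result \<open>Q T = c * Q []\<close> shows that
  the arc \<open>T\<close> contributes the factor \<open>c\<close> in any such surroundings, which
  yields products for connected sums.\<close>

locale skein_context =
  fixes P :: "bool diagram \<Rightarrow> laurent2" and U V :: "bool diagram" and d :: bool and ys :: "bool list"
  assumes homfly: "homfly_polynomial P"
    and above: "through U [] = Some [d, \<not> d]" and below: "through V ys = Some []"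
begin

definition Q :: "bool diagram \<Rightarrow> laurent2" where
  "Q T = P (U @ T @ V)"

lemma Q_isotopic:
  assumes "tangle_isotopic [d, \<not> d] S T" and "through S [d, \<not> d] = Some ys"
  shows "Q S = Q T"
  using homfly isotopic_tangle[OF assms(1) above assms(2) below]
  unfolding homfly_polynomial_def Q_def by blast

lemmas Q_moves = Q_isotopic[OF apply_moves_sound]

lemma Q_skein:
  assumes "through S [d, \<not> d] = Some zs" and "(zs ! i = zs ! (i + 1)) = s"
    and "through (S @ (i, Cross s) # R) [d, \<not> d] = Some ys"
  shows "a * Q (S @ (i, Cross s) # R) + a' * Q (S @ (i, Cross (\<not> s)) # R)
    + m * Q (S @ oriented_smoothing zs i @ R) = 0"
proof -
  have "through (U @ S) [] = Some zs"
    using assms(1) above by (simp add: through_append)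
  moreover have "crossing_sign zs (i, Cross s :: bool piece) = 1"
    using assms(2) by simp
  moreover have "link_diagram (U @ (S @ (i, Cross s) # R) @ V)"
    using above below assms(3) unfolding link_diagram_def through_append[of U] through_append[of _ V]
    by simp
  ultimately have "skein_triple (U @ (S @ (i, Cross s) # R) @ V) (U @ (S @ (i, Cross (\<not> s)) # R) @ V)
    (U @ (S @ oriented_smoothing zs i @ R) @ V)"
    unfolding skein_triple_def by (intro conjI exI[of _ "U @ S"] exI[of _ "R @ V"] exI[of _ zs]) auto
  then show ?thesis
    using homfly unfolding homfly_polynomial_def Q_def by blast
qed

context
  assumes ys: "ys = [d, \<not> d]"
begin

text \<open>Curls of both signs are trivial, and smoothing one splits off the circle.\<close>

lemma Q_circle: "Q [(2, Cap (\<not> d)), (2, Cup)] = - m' * (a + a') * Q []"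
proof -
  have "a * Q [(2, Cap (\<not> d)), (1, Cross True), (2, Cup)]
    + a' * Q [(2, Cap (\<not> d)), (1, Cross False), (2, Cup)] + m * Q [(2, Cap (\<not> d)), (2, Cup)] = 0"
    using Q_skein[of "[(2, Cap (\<not> d))]" "[d, \<not> d, \<not> d, d]" 1 True "[(2, Cup)]"] ys
    by (cases d) (simp_all add: oriented_smoothing_def)
  moreover have "Q [(2, Cap (\<not> d)), (1, Cross s), (2, Cup)] = Q []" for s
    by (rule Q_moves[of "[(0, True, R1 1 (\<not> d) s)]"]) (cases d; simp add: ys)+
  ultimately have "Q [(2, Cap (\<not> d)), (2, Cup)] = - m' * (a * Q [] + a' * Q [])"
    using skein_solve(3) by metis
  then show ?thesis
    by (simp only: distrib_right mult.assoc)
qed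

text \<open>The factor of a trefoil summand. The twisted strands are parallel, so
  \<open>f k = - a * (a * f (k - 2) + m * f (k - 1))\<close> for \<open>k\<close> negative
  crossings, with \<open>f 0\<close> a circle and \<open>f 1\<close> a curl.\<close>

lemma Q_right_twist_3:
  "Q [(2, Cap (\<not> d)), (1, Cross False), (1, Cross False), (1, Cross False), (2, Cup)] =
    - a * (a + m * (- a * (- a * m' * (a + a') + m))) * Q []"
proof -
  let ?f = "\<lambda>D. Q ((2, Cap (\<not> d)) # D @ [(2, Cup)])"
  let ?p = "(1, Cross True) :: nat \<times> bool piece" and ?n = "(1, Cross False) :: nat \<times> bool piece"
  have skein: "a * ?f (?p # R) + a' * ?f (?n # R) + m * ?f R = 0" if "R = [?n] \<or> R = [?n, ?n]" for R
    using that Q_skein[of "[(2, Cap (\<not> d))]" "[d, \<not> d, \<not> d, d]" 1 True "R @ [(2, Cup)]"] ys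
    by (cases d) (auto simp: oriented_smoothing_def)
  have 1: "?f [?n] = Q []"
    using Q_moves[of "[(0, True, R1 1 (\<not> d) False)]" "[(2, Cap (\<not> d)), ?n, (2, Cup)]"]
    by (cases d) (simp_all add: ys)
  have 2: "?f [?p, ?n] = ?f []" "?f [?p, ?n, ?n] = ?f [?n]"
    by (rule Q_moves[of "[(1, True, R2 1 True)]"]; cases d; simp add: ys)+
  have 3: "?f [?n, ?n] = - a * (a * ?f [] + m * Q [])"
    using skein_solve(2)[OF skein[of "[?n]"]] by (simp only: 1 2 simp_thms)
  have "?f [?n, ?n, ?n] = - a * (a * Q [] + m * ?f [?n, ?n])"
    using skein_solve(2)[OF skein[of "[?n, ?n]"]] by (simp only: 1 2 simp_thms)
  also have "\<dots> = - a * (a + m * (- a * (- a * m' * (a + a') + m))) * Q []"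
    unfolding 3 append_Nil Q_circle
    by (simp only: algebra_simps mult_minus_left mult_minus_right minus_minus minus_add_distrib)
  finally show ?thesis
    by simp
qed

text \<open>Changing the \<open>\<sigma>\<^sub>2\<close> crossing unknots the arc; smoothing it
  leaves, after removal of a curl, a circle clasped with the strand (\<open>?h\<close>), resolved by
  a second skein relation.\<close>

lemma Q_4_1:
  "Q ((2, Cap (\<not> d)) # [(1, Cross False), (2, Cross True), (1, Cross False), (1, Cross False)]
     @ [(2, Cup)]) = - a * (a + m * (- a' * (- a' * m' * (a + a') + m))) * Q []"
proof -
  let ?n = "(1, Cross False) :: nat \<times> bool piece"
  let ?h = "Q [(2, Cap d), ?n, ?n, (2, Cup)]"
  \<comment> \<open>The strands at positions 2 and 3 are antiparallel, so \<open>Cross False\<close>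
    is positive and the smoothing is a cup above a cap.\<close>
  have "a * Q [(2, Cap (\<not> d)), ?n, (2, Cross False), ?n, ?n, (2, Cup)]
    + a' * Q [(2, Cap (\<not> d)), ?n, (2, Cross True), ?n, ?n, (2, Cup)]
    + m * Q [(2, Cap (\<not> d)), ?n, (2, Cup), (2, Cap d), ?n, ?n, (2, Cup)] = 0"
    using Q_skein[of "[(2, Cap (\<not> d)), ?n]" "[d, \<not> d, \<not> d, d]" 2 False "[?n, ?n, (2, Cup)]"] ys
    by (cases d) (auto simp: oriented_smoothing_def)
  moreover have "Q [(2, Cap (\<not> d)), ?n, (2, Cross False), ?n, ?n, (2, Cup)] = Q []"
    by (rule Q_isotopic[OF unknotted_4_1]) (cases d; simp add: ys)
  moreover have "Q [(2, Cap (\<not> d)), ?n, (2, Cup), (2, Cap d), ?n, ?n, (2, Cup)] = ?h"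
    by (rule Q_moves[of "[(0, True, R1 1 (\<not> d) False)]"]; cases d; simp add: ys)
  ultimately have 1: "Q [(2, Cap (\<not> d)), ?n, (2, Cross True), ?n, ?n, (2, Cup)] = - a * (a * Q [] + m * ?h)"
    using skein_solve(2) by metis
  have "a * ?h + a' * Q [(2, Cap d), (1, Cross True), ?n, (2, Cup)]
    + m * Q [(2, Cap d), (1, Cup), (1, Cap d), ?n, (2, Cup)] = 0"
    using Q_skein[of "[(2, Cap d)]" "[d, \<not> d, d, \<not> d]" 1 False "[?n, (2, Cup)]"] ys
    by (cases d) (auto simp: oriented_smoothing_def)
  moreover have "Q [(2, Cap d), (1, Cross True), ?n, (2, Cup)] = Q [(2, Cap d), (2, Cup)]"
    by (rule Q_moves[of "[(1, True, R2 1 True)]"]; cases d; simp add: ys)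
  \<comment> \<open>This circle carries the label opposite to the one in
    \<open>Q_circle\<close>.\<close>
  moreover have "Q [(2, Cap d), (2, Cup)] = Q [(2, Cap (\<not> d)), (2, Cup)]"
    by (rule Q_isotopic[OF circle_reverse]) (cases d; simp add: ys)
  moreover have "Q [(2, Cap d), (1, Cup), (1, Cap d), ?n, (2, Cup)] = Q []"
    by (rule Q_isotopic[OF smoothed_clasp]) (cases d; simp add: ys)
  ultimately have 2: "?h = - a' * (a' * Q [(2, Cap (\<not> d)), (2, Cup)] + m * Q [])"
    using skein_solve(1) by metis
  show ?thesis
    unfolding append_Cons append_Nil 1 2 Q_circle
    by (simp only: algebra_simps mult_minus_left mult_minus_right minus_minus minus_add_distrib)
qed

end

text \<open>Parallel twisted strands again:
  \<open>g k = - a' * (a' * g (k - 2) + m * g (k - 1))\<close> with \<open>g 1 = 1\<close>. The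
  window includes the closing cup, around which a single curl is removed.\<close>

lemma Q_left_twist_4:
  assumes ys: "ys = []"
  shows "Q [(1, Cap d), (2, Cross True), (2, Cross True), (2, Cross True), (2, Cross True), (1, Cup), (0, Cup)] =
    (let g0 = - m' * (a + a'); g2 = - a' * (a' * g0 + m); g3 = - a' * (a' + m * g2)
     in - a' * (a' * g2 + m * g3)) * Q [(0, Cup)]"
proof -
  let ?f = "\<lambda>D. Q ((1, Cap d) # D @ [(1, Cup), (0, Cup)])"
  let ?p = "(2, Cross True) :: nat \<times> bool piece" and ?n = "(2, Cross False) :: nat \<times> bool piece"
  have skein: "a * ?f (?p # R) + a' * ?f (?n # R) + m * ?f R = 0"
    if "R \<in> {[], [?p], [?p, ?p], [?p, ?p, ?p]}" for R
    using that Q_skein[of "[(1, Cap d)]" "[d, d, \<not> d, \<not> d]" 2 True "R @ [(1, Cup), (0, Cup)]"] ys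
    by (cases d) (auto simp: oriented_smoothing_def)
  have 1: "?f [?p] = Q [(0, Cup)]" "?f [?n] = Q [(0, Cup)]"
    using Q_isotopic[OF left_curl_True] Q_isotopic[OF left_curl_False]
    by (cases d; simp add: ys)+
  have 2: "?f [?n, ?p] = ?f []" "?f [?n, ?p, ?p] = ?f [?p]" "?f [?n, ?p, ?p, ?p] = ?f [?p, ?p]"
    by (rule Q_moves[of "[(1, True, R2 2 False)]"]; cases d; simp add: ys)+
  define g0 where "g0 = - m' * (a + a')"
  define g2 where "g2 = - a' * (a' * g0 + m)"
  define g3 where "g3 = - a' * (a' + m * g2)"
  have 3: "?f [] = g0 * Q [(0, Cup)]"
    using skein_solve(3)[OF skein[of "[]"]]
    by (simp only: 1 insert_iff simp_thms g0_def mult.assoc distrib_right)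
  have 4: "?f [?p, ?p] = g2 * Q [(0, Cup)]"
    using skein_solve(1)[OF skein[of "[?p]"]]
    by (simp only: 1 2 3 insert_iff simp_thms g2_def mult.assoc distrib_right)
  have 5: "?f [?p, ?p, ?p] = g3 * Q [(0, Cup)]"
    using skein_solve(1)[OF skein[of "[?p, ?p]"]]
    by (simp only: 1 2 4 insert_iff simp_thms g3_def mult.assoc distrib_right)
  have "?f [?p, ?p, ?p, ?p] = - a' * (a' * g2 + m * g3) * Q [(0, Cup)]"
    using skein_solve(1)[OF skein[of "[?p, ?p, ?p]"]]
    by (simp only: 2 4 5 insert_iff simp_thms mult.assoc distrib_right)
  then show ?thesis
    unfolding Let_def g3_def g2_def g0_def by (simp only: append_Cons append_Nil)
qed

end

section \<open>HOMFLY polynomials of the two knots\<close>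

lemma homfly_unknot:
  "homfly_polynomial P \<Longrightarrow> P [(0, Cap d), (0, Cup)] = 1"
  by (simp add: homfly_polynomial_def)

text \<open>Two windows in turn: the upper arc is replaced while the lower one belongs to the
  surroundings, then the lower one; each contributes the factor of \<open>Q_4_1\<close>.\<close>

lemma homfly_sum:
  assumes "homfly_polynomial P"
  shows "P (oriented_sum d) = (- a * (a + m * (- a' * (- a' * m' * (a + a') + m))))\<^sup>2"
proof -
  let ?T = "(2, Cap (\<not> d)) # braid_4_1 @ [(2, Cup)]"
  interpret upper: skein_context P "[(0, Cap d)]" "?T @ [(0, Cup)]" d "[d, \<not> d]"
    by unfold_locales (use assms in \<open>cases d; simp\<close>)+
  interpret lower: skein_context P "[(0, Cap d)]" "[(0, Cup)]" d "[d, \<not> d]"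
    by unfold_locales (use assms in \<open>cases d; simp\<close>)+
  have "P (oriented_sum d) = upper.Q ?T"
    unfolding oriented_sum_def upper.Q_def by simp
  moreover have "upper.Q [] = lower.Q ?T"
    unfolding upper.Q_def lower.Q_def by simp
  moreover have "lower.Q [] = 1"
    using homfly_unknot[OF assms] unfolding lower.Q_def by simp
  ultimately show ?thesis
    using upper.Q_4_1[OF refl] lower.Q_4_1[OF refl] by (simp only: power2_eq_square mult_1_right)
qed

lemma homfly_8_9:
  assumes "homfly_polynomial P"
  shows "P (oriented_8_9 d) =
    - a * (a + m * (- a * (a + m * (- a * (- a * m' * (a + a') + m))) *
      (let g0 = - m' * (a + a'); g2 = - a' * (a' * g0 + m); g3 = - a' * (a' + m * g2)
       in - a' * (a' * g2 + m * g3))))"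
proof -
  let ?n = "(1, Cross False) :: nat \<times> bool piece" and ?p = "(2, Cross True) :: nat \<times> bool piece"
  \<comment> \<open>Smoothing inserts a cup, which ends the trefoil arc \<open>?A\<close>, and a
    cap, which begins the torus link part \<open>?B\<close>.\<close>
  let ?A = "[(2, Cap (\<not> d)), ?n, ?n, ?n, (2, Cup)]"
  let ?B = "[(2, Cap d), ?n, ?p, ?p, ?n, (2, Cup)]"
  interpret whole: skein_context P "[(0, Cap d)]" "[(0, Cup)]" d "[d, \<not> d]"
    by unfold_locales (use assms in \<open>cases d; simp\<close>)+
  interpret trefoil: skein_context P "[(0, Cap d)]" "?B @ [(0, Cup)]" d "[d, \<not> d]"
    by unfold_locales (use assms in \<open>cases d; simp\<close>)+
  interpret torus: skein_context P "[(0, Cap d)]" "[]" d "[]"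
    by unfold_locales (use assms in \<open>cases d; simp\<close>)+
  have unknot: "whole.Q [] = 1" "torus.Q [(0, Cup)] = 1"
    using homfly_unknot[OF assms] unfolding whole.Q_def torus.Q_def by simp_all
  have "a * whole.Q ([(2, Cap (\<not> d)), ?n, ?n, ?n] @ (2, Cross False) # [?n, ?p, ?p, ?n, (2, Cup)])
    + a' * whole.Q ([(2, Cap (\<not> d)), ?n, ?n, ?n] @ ?p # [?n, ?p, ?p, ?n, (2, Cup)])
    + m * whole.Q (?A @ ?B) = 0"
    using whole.Q_skein[of "[(2, Cap (\<not> d)), ?n, ?n, ?n]" "[d, \<not> d, \<not> d, d]" 2 False
        "[?n, ?p, ?p, ?n, (2, Cup)]"]
    by (cases d) (auto simp: oriented_smoothing_def)
  moreover have
    "whole.Q ([(2, Cap (\<not> d)), ?n, ?n, ?n] @ (2, Cross False) # [?n, ?p, ?p, ?n, (2, Cup)]) = 1"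
    unfolding unknot(1)[symmetric] append_Cons append_Nil
    by (rule whole.Q_isotopic[OF tangle_isotopic_trans[OF changed_8_9 unknotted_4_1]])
      (cases d; simp)
  moreover have "P (oriented_8_9 d) =
    whole.Q ([(2, Cap (\<not> d)), ?n, ?n, ?n] @ ?p # [?n, ?p, ?p, ?n, (2, Cup)])"
    unfolding oriented_8_9_def whole.Q_def by simp
  ultimately have K: "P (oriented_8_9 d) = - a * (a * 1 + m * whole.Q (?A @ ?B))"
    using skein_solve(2) by metis
  have "whole.Q (?A @ ?B) = trefoil.Q ?A"
    unfolding whole.Q_def trefoil.Q_def by simp
  also have "\<dots> = - a * (a + m * (- a * (- a * m' * (a + a') + m))) * trefoil.Q []"
    by (rule trefoil.Q_right_twist_3[OF refl])
  also have "trefoil.Q [] = whole.Q ?B"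
    unfolding whole.Q_def trefoil.Q_def by simp
  also have "\<dots> = whole.Q [(1, Cap d), ?p, ?p, ?p, ?p, (1, Cup)]"
    by (rule whole.Q_isotopic[OF twist_region_4]) (cases d; simp)
  also have "\<dots> = torus.Q [(1, Cap d), ?p, ?p, ?p, ?p, (1, Cup), (0, Cup)]"
    unfolding whole.Q_def torus.Q_def by simp
  also note torus.Q_left_twist_4[OF refl]
  finally show ?thesis
    unfolding K unknot by (simp only: mult_1_right)
qed

lemma numeral_times_single:
  "numeral n * Poly_Mapping.single k c = Poly_Mapping.single k (numeral n * c :: int)"
  by (simp add: mult_single flip: single_numeral)

lemma homfly_distinct:
  assumes "homfly_polynomial P"
  shows "P (oriented_8_9 d) \<noteq> P (oriented_sum e)"
proof -
  \<comment> \<open>The leading terms in \<open>m\<close> are \<open>a^2 m^2\<close> for the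
    trefoil, \<open>- a^-3 m^3\<close> for the torus link and \<open>- a m\<close> for the skein
    step; their product is \<open>m^6\<close>.\<close>
  have "Poly_Mapping.lookup (P (oriented_8_9 d)) (0, 6) = 1"
    unfolding homfly_8_9[OF assms]
    by (simp add: Let_def algebra_simps mult_single lookup_add lookup_single lookup_minus
        numeral_times_single)
  moreover have "Poly_Mapping.lookup (P (oriented_sum e)) (0, 6) = 0"
    unfolding homfly_sum[OF assms] power2_eq_square
    by (simp add: algebra_simps mult_single lookup_add lookup_single lookup_minus
        numeral_times_single)
  ultimately show ?thesis
    by auto
qed

section \<open>Jones polynomials\<close>

text \<open>Terms are kept in order of exponent with like terms merged, so that polynomials can be
  compared as lists.\<close>

fun add_term :: "int \<times> int \<Rightarrow> (int \<times> int) list \<Rightarrow> (int \<times> int) list" where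
  "add_term (k, c) [] = [(k, c)]"
| "add_term (k, c) ((l, b) # p) =
     (if k = l then (k, b + c) # p else if k < l then (k, c) # (l, b) # p
      else (l, b) # add_term (k, c) p)"

definition laurent_of :: "(int \<times> int) list \<Rightarrow> laurent" where
  "laurent_of p = (\<Sum>(k, c) \<leftarrow> p. Poly_Mapping.single k c)"

text \<open>The powers of the loop value \<open>- A^2 - A^-2\<close>.\<close>

fun loop_power :: "nat \<Rightarrow> (int \<times> int) list" where
  "loop_power 0 = [(0, 1)]"
| "loop_power (Suc n) = (let p = loop_power n in
     fold add_term (map (\<lambda>(k, c). (k + 2, - c)) p) (map (\<lambda>(k, c). (k - 2, - c)) p))"

text \<open>Cancelled terms stay in the list with coefficient 0 and must be filtered out to give a
  normal form.\<close>

definition bracket_list :: "unit diagram \<Rightarrow> (int \<times> int) list" where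
  "bracket_list D = filter (\<lambda>(k, c). c \<noteq> 0)
     (fold (\<lambda>(k, n). fold add_term (map (\<lambda>(l, c). (k + l, c)) (loop_power n)))
       (map (\<lambda>(k, S). (k, components S - 1)) (kauffman_states D)) [])"

lemma laurent_of_add_term: "laurent_of (add_term t p) = laurent_of [t] + laurent_of p"
  by (induction t p rule: add_term.induct) (auto simp: laurent_of_def single_add)

lemma laurent_of_fold: "laurent_of (fold add_term p q) = laurent_of p + laurent_of q"
  by (induction p arbitrary: q) (auto simp: laurent_of_add_term, auto simp: laurent_of_def)

lemma laurent_of_shift:
  "laurent_of (map (\<lambda>(l, c). (k + l, c)) p) = Poly_Mapping.single k 1 * laurent_of p"
  by (induction p) (auto simp: laurent_of_def mult_single distrib_left)

lemma laurent_of_loop_power: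
  "laurent_of (loop_power n) = (- Poly_Mapping.single 2 1 - Poly_Mapping.single (- 2) 1) ^ n"
proof (induction n)
  case 0
  then show ?case by (simp add: laurent_of_def)
next
  case (Suc n)
  have "laurent_of (map (\<lambda>(k, c). (k + j, - c)) p) = - Poly_Mapping.single j 1 * laurent_of p" for j p
    by (induction p) (auto simp: laurent_of_def mult_single distrib_left single_uminus algebra_simps)
  from this[of 2] this[of "-2"] Suc show ?case
    by (simp add: Let_def laurent_of_fold algebra_simps)
qed

lemma laurent_of_filter: "laurent_of (filter (\<lambda>(k, c). c \<noteq> 0) p) = laurent_of p"
  by (induction p) (auto simp: laurent_of_def)

lemma kauffman_bracket_eq: "kauffman_bracket D = laurent_of (bracket_list D)"
proof -
  have "laurent_of (fold (\<lambda>(k, n). fold add_term (map (\<lambda>(l, c). (k + l, c)) (loop_power n))) ts p) =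
    (\<Sum>(k, n) \<leftarrow> ts. Poly_Mapping.single k 1 *
       (- Poly_Mapping.single 2 1 - Poly_Mapping.single (- 2) 1) ^ n) + laurent_of p" for ts p
    by (induction ts arbitrary: p) (auto simp: laurent_of_fold laurent_of_shift laurent_of_loop_power)
  from this[of "map (\<lambda>(k, S). (k, components S - 1)) (kauffman_states D)" "[]"] show ?thesis
    unfolding bracket_list_def laurent_of_filter kauffman_bracket_def
    by (simp add: laurent_of_def comp_def case_prod_unfold)
qed

text \<open>Both diagrams have 8 crossings, so each state sum has \<open>2^8\<close> terms and is
  evaluated outright.\<close>

lemma bracket_list_8_9_sum: "bracket_list knot_8_9 = bracket_list (butlast knot_4_1 @ tl knot_4_1)"
  by code_simp

text \<open>Both writhes vanish, so equality of the brackets suffices.\<close>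

lemma jones_eq: "jones_polynomial (oriented_8_9 d) = jones_polynomial (oriented_sum e)"
proof -
  have "writhe (oriented_8_9 d) = 0"
    by (cases d) (simp_all add: oriented_8_9_def writhe_def)
  moreover have "writhe (oriented_sum e) = 0"
    by (cases e) (simp_all add: oriented_sum_def writhe_def)
  moreover have "forget_orientation (oriented_8_9 d) = knot_8_9"
    unfolding knot_8_9_eq by (simp add: forget_orientation_def oriented_8_9_def)
  moreover have "forget_orientation (oriented_sum e) = butlast knot_4_1 @ tl knot_4_1"
    unfolding knot_4_1_eq by (simp add: forget_orientation_def oriented_sum_def)
  ultimately show ?thesis
    by (simp add: jones_polynomial_def kauffman_bracket_eq bracket_list_8_9_sum)
qed

theorem mainTheorem2:
  fixes K D :: "bool diagram"
  assumes "orientation_of K knot_8_9"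
    and "orientation_of D knot_4_1"
  shows "bridge_knot 2 K \<and> bridge_knot 3 (connected_sum D D) \<and>
    jones_polynomial K = jones_polynomial (connected_sum D D) \<and>
    (\<forall>P. homfly_polynomial P \<longrightarrow> P K \<noteq> P (connected_sum D D))"
proof -
  obtain d where K: "K = oriented_8_9 d"
    using assms(1) by (rule orientation_8_9)
  obtain e where D: "D = oriented_4_1 e"
    using assms(2) by (rule orientation_4_1)
  show ?thesis
    unfolding K D connected_sum_4_1
    using bridge_knot_8_9 bridge_knot_sum jones_eq homfly_distinct by blast
qed

end
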